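(* Let $\Omega\subset\mathbb{R}^2$ be an open set, $f:\Omega\to\mathbb{R}$ a smooth function, and let $S=\{(x,y,f(x,y)):(x,y)\in\Omega\}\subset\mathcal{H}_3$ be its graph in the Heisenberg group. Let $H$ and $\phi=(\phi^1,\phi^2):\Omega\to\mathcal{P}$ be the mean curvature and the Gauss map of $S$, respectively. Then the tension field $\tau(\phi)=(\tau(\phi^1),\tau(\phi^2))$ of the Gauss map satisfies $$\tau(\phi^1)+2wH_x=H\left[\frac{2\left(f_y-\frac{x}{2}\right)}{w}-4\frac{\partial w}{\partial x}+4\left(f_x+\frac{y}{2}\right)Hw^2\right],$$ $$\tau(\phi^2)+2wH_y=H\left[\frac{-2\left(f_x+\frac{y}{2}\right)}{w}-4\frac{\partial w}{\partial y}+4\left(f_y-\frac{x}{2}\right)Hw^2\right],$$ where $w=\sqrt{1+\left(f_x+\frac{y}{2}\right)^2+\left(f_y-\frac{x}{2}\right)^2}$.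
   Context: The Heisenberg group $\mathcal{H}_3$ is $\mathbb{R}^3$ with the product $(a,b,c)*(x,y,z)=(a+x,\,b+y,\,c+z+\frac{ay-bx}{2})$ and the left-invariant Riemannian metric $ds^2=dx^2+dy^2+\left(\frac12 y\,dx-\frac12 x\,dy+dz\right)^2$. The graph $S$ is parametrized by $X(x,y)=(x,y,f(x,y))$, $(x,y)\in\Omega$. Write $p=f_x+\frac y2$, $q=f_y-\frac x2$; subscripts denote partial derivatives. The induced metric $g=(g_{ij})$ on $S$ (pulled back to $\Omega$, with coordinates $x^1=x$, $x^2=y$) is $g_{11}=1+p^2$, $g_{12}=g_{21}=pq$, $g_{22}=1+q^2$, and $\det g=w^2$; $(g^{ij})$ denotes the inverse matrix. The mean curvature $H$ of $S$ (with respect to the unit normal with positive vertical component) is given by $$2H=\frac{(1+q^2)f_{xx}-2pq\,f_{xy}+(1+p^2)f_{yy}}{(1+p^2+q^2)^{3/2}}.$$ The Gans model $\mathcal{P}$ of the hyperbolic plane is $\mathbb{R}^2$ with coordinates $(u,v)$ and the metric $$h=\frac{(1+v^2)\,du^2-2uv\,du\,dv+(1+u^2)\,dv^2}{1+u^2+v^2}.$$ The Gauss map of $S$ (the unit normal left-translated to the identity, followed by central projection from the origin of the open upper hemisphere onto the plane $z=1$, identified with $\mathcal{P}$), written in the parametrization $X$, is $$\phi(x,y)=(\phi^1,\phi^2)=\left(-\left(f_x+\tfrac y2\right),\,-\left(f_y-\tfrac x2\right)\right).$$ The tension field of $\phi:(\Omega,g)\to(\mathcal{P},h)$ has components $$\tau(\phi^\alpha)=\Delta\phi^\alpha+\sum_{i,j,\beta,\gamma=1}^{2}\Gamma'^{\alpha}_{\beta\gamma}(\phi)\,\frac{\partial\phi^\beta}{\partial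 x^i}\,\frac{\partial\phi^\gamma}{\partial x^j}\,g^{ij},\qquad \alpha=1,2,$$ where $\Delta\psi=\frac{1}{\sqrt{\det g}}\sum_{i,j}\partial_{x^i}\left(\sqrt{\det g}\,g^{ij}\,\partial_{x^j}\psi\right)$ is the Laplace operator of $(\Omega,g)$ and $\Gamma'^{\alpha}_{\beta\gamma}$ are the Christoffel symbols of $h$, evaluated at $\phi$. *)

theory Defs
  imports "HOL-Analysis.Analysis"
begin

definition partial :: "'n::finite \<Rightarrow> (real ^ 'n \<Rightarrow> real) \<Rightarrow> real ^ 'n \<Rightarrow> real" where
  "partial i F z = deriv (\<lambda>t. F (z + t *\<^sub>R axis i 1)) 0"

definition partial_vec :: "'n::finite \<Rightarrow> (real ^ 'n \<Rightarrow> real ^ 'm) \<Rightarrow> real ^ 'n \<Rightarrow> real ^ 'm" where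
  "partial_vec i F z = (\<chi> k. partial i (\<lambda>z'. F z' $ k) z)"

primrec Ck_on :: "nat \<Rightarrow> (real ^ 'n::finite) set \<Rightarrow> (real ^ 'n \<Rightarrow> real) \<Rightarrow> bool" where
  "Ck_on 0 S F \<longleftrightarrow> continuous_on S F"
| "Ck_on (Suc k) S F \<longleftrightarrow> F differentiable_on S \<and> (\<forall>i. Ck_on k S (partial i F))"

text \<open>Meaningful for open \<open>S\<close> only; the values of \<open>F\<close> outside \<open>S\<close> then play no role.\<close>

definition smooth_on :: "(real ^ 'n::finite) set \<Rightarrow> (real ^ 'n \<Rightarrow> real) \<Rightarrow> bool" where
  "smooth_on S F \<longleftrightarrow> (\<forall>k. Ck_on k S F)"

text \<open>A metric in coordinates is given by its Gram matrix at each point.\<close>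

type_synonym 'n metric = "real ^ 'n \<Rightarrow> real ^ 'n ^ 'n"

text \<open>\<open>christoffel G a b c\<close> is the symbol with upper index \<open>a\<close> and lower indices \<open>b\<close>, \<open>c\<close>.\<close>

definition christoffel :: "'n::finite metric \<Rightarrow> 'n \<Rightarrow> 'n \<Rightarrow> 'n \<Rightarrow> real ^ 'n \<Rightarrow> real" where
  "christoffel G a b c z =
     1/2 * (\<Sum>d\<in>UNIV. matrix_inv (G z) $ a $ d *
       (partial b (\<lambda>z'. G z' $ d $ c) z + partial c (\<lambda>z'. G z' $ d $ b) z
        - partial d (\<lambda>z'. G z' $ b $ c) z))"

definition laplace :: "'n::finite metric \<Rightarrow> (real ^ 'n \<Rightarrow> real) \<Rightarrow> real ^ 'n \<Rightarrow> real" where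
  "laplace g \<psi> z = 1 / sqrt (det (g z)) *
     (\<Sum>i\<in>UNIV. \<Sum>j\<in>UNIV.
        partial i (\<lambda>z'. sqrt (det (g z')) * matrix_inv (g z') $ i $ j * partial j \<psi> z') z)"

definition tension ::
  "'n::finite metric \<Rightarrow> 'm::finite metric \<Rightarrow> (real ^ 'n \<Rightarrow> real ^ 'm) \<Rightarrow> real ^ 'n \<Rightarrow> real ^ 'm" where
  "tension g h \<phi> z = (\<chi> \<alpha>. laplace g (\<lambda>z'. \<phi> z' $ \<alpha>) z +
     (\<Sum>i\<in>UNIV. \<Sum>j\<in>UNIV. \<Sum>\<beta>\<in>UNIV. \<Sum>\<gamma>\<in>UNIV.
        christoffel h \<alpha> \<beta> \<gamma> (\<phi> z) *
        partial i (\<lambda>z'. \<phi> z' $ \<beta>) z * partial j (\<lambda>z'. \<phi> z' $ \<gamma>) z *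
        matrix_inv (g z) $ i $ j))"

definition heis_mult :: "real ^ 3 \<Rightarrow> real ^ 3 \<Rightarrow> real ^ 3" where
  "heis_mult P Q = vector [P$1 + Q$1, P$2 + Q$2, P$3 + Q$3 + (P$1 * Q$2 - P$2 * Q$1) / 2]"

definition heis_inv :: "real ^ 3 \<Rightarrow> real ^ 3" where
  "heis_inv P = - P"

lemma heis_mult_inv: "heis_mult (heis_inv P) P = 0" "heis_mult P (heis_inv P) = 0"
  by (simp_all add: heis_mult_def heis_inv_def vec_eq_iff forall_3 vector_3)

text \<open>The 1-form \<open>y dx / 2 - x dy / 2 + dz\<close>.\<close>

definition heis_form :: "real ^ 3 \<Rightarrow> real ^ 3 \<Rightarrow> real" where
  "heis_form P V = P$2 * V$1 / 2 - P$1 * V$2 / 2 + V$3"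

definition heis_inner :: "real ^ 3 \<Rightarrow> real ^ 3 \<Rightarrow> real ^ 3 \<Rightarrow> real" where
  "heis_inner P V W = V$1 * W$1 + V$2 * W$2 + heis_form P V * heis_form P W"

definition heis_metric :: "3 metric" where
  "heis_metric P = (\<chi> a b. heis_inner P (axis a 1) (axis b 1))"

definition left_translate_to_id :: "real ^ 3 \<Rightarrow> real ^ 3 \<Rightarrow> real ^ 3" where
  "left_translate_to_id P V = frechet_derivative (heis_mult (heis_inv P)) (at P) V"

definition graph_param :: "(real ^ 2 \<Rightarrow> real) \<Rightarrow> real ^ 2 \<Rightarrow> real ^ 3" where
  "graph_param f z = vector [z$1, z$2, f z]"

definition induced_metric :: "(real ^ 2 \<Rightarrow> real) \<Rightarrow> 2 metric" where
  "induced_metric f z = (\<chi> i j. heis_inner (graph_param f z)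
     (partial_vec i (graph_param f) z) (partial_vec j (graph_param f) z))"

text \<open>The vertical direction is the left-invariant field \<open>\<partial>\<^sub>z\<close>, i.e. \<open>axis 3 1\<close> at every point.\<close>

definition unit_normal :: "(real ^ 2 \<Rightarrow> real) \<Rightarrow> real ^ 2 \<Rightarrow> real ^ 3" where
  "unit_normal f z = (THE N. heis_inner (graph_param f z) N N = 1 \<and>
     (\<forall>i. heis_inner (graph_param f z) N (partial_vec i (graph_param f) z) = 0) \<and>
     heis_inner (graph_param f z) N (axis 3 1) > 0)"

text \<open>The Levi-Civita covariant derivative of \<open>\<partial>X/\<partial>x\<^sup>j\<close> in the direction \<open>\<partial>X/\<partial>x\<^sup>i\<close>,
  where \<open>X\<close> is the graph parametrization.\<close>

definition cov_deriv :: "(real ^ 2 \<Rightarrow> real) \<Rightarrow> 2 \<Rightarrow> 2 \<Rightarrow> real ^ 2 \<Rightarrow> real ^ 3" where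
  "cov_deriv f i j z = partial_vec i (partial_vec j (graph_param f)) z +
     (\<chi> a. \<Sum>b\<in>UNIV. \<Sum>c\<in>UNIV. christoffel heis_metric a b c (graph_param f z) *
        partial_vec i (graph_param f) z $ b * partial_vec j (graph_param f) z $ c)"

definition mean_curvature :: "(real ^ 2 \<Rightarrow> real) \<Rightarrow> real ^ 2 \<Rightarrow> real" where
  "mean_curvature f z = 1/2 * (\<Sum>i\<in>UNIV. \<Sum>j\<in>UNIV. matrix_inv (induced_metric f z) $ i $ j *
     heis_inner (graph_param f z) (cov_deriv f i j z) (unit_normal f z))"

text \<open>Central projection from the origin onto the plane \<open>z = 1\<close>.\<close>

definition central_proj :: "real ^ 3 \<Rightarrow> real ^ 2" where
  "central_proj n = vector [n$1 / n$3, n$2 / n$3]"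

definition gauss_map :: "(real ^ 2 \<Rightarrow> real) \<Rightarrow> real ^ 2 \<Rightarrow> real ^ 2" where
  "gauss_map f z = central_proj (left_translate_to_id (graph_param f z) (unit_normal f z))"

definition gans_metric :: "2 metric" where
  "gans_metric z = (let u = z$1; v = z$2 in
     (1 / (1 + u\<^sup>2 + v\<^sup>2)) *\<^sub>R vector [vector [1 + v\<^sup>2, - (u * v)], vector [- (u * v), 1 + u\<^sup>2]])"

definition slope_p :: "(real ^ 2 \<Rightarrow> real) \<Rightarrow> real ^ 2 \<Rightarrow> real" where
  "slope_p f z = partial 1 f z + z$2 / 2"

definition slope_q :: "(real ^ 2 \<Rightarrow> real) \<Rightarrow> real ^ 2 \<Rightarrow> real" where
  "slope_q f z = partial 2 f z - z$1 / 2"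

definition area_w :: "(real ^ 2 \<Rightarrow> real) \<Rightarrow> real ^ 2 \<Rightarrow> real" where
  "area_w f z = sqrt (1 + (slope_p f z)\<^sup>2 + (slope_q f z)\<^sup>2)"

lemma gans_metric_nth:
  "gans_metric z $ 1 $ 1 = (1 + (z$2)\<^sup>2) / (1 + (z$1)\<^sup>2 + (z$2)\<^sup>2)"
  "gans_metric z $ 1 $ 2 = - (z$1 * z$2) / (1 + (z$1)\<^sup>2 + (z$2)\<^sup>2)"
  "gans_metric z $ 2 $ 1 = - (z$1 * z$2) / (1 + (z$1)\<^sup>2 + (z$2)\<^sup>2)"
  "gans_metric z $ 2 $ 2 = (1 + (z$1)\<^sup>2) / (1 + (z$1)\<^sup>2 + (z$2)\<^sup>2)"
  by (simp_all add: gans_metric_def Let_def)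

lemma partial_const [simp]: "partial i (\<lambda>z. c) z = 0"
  by (simp add: partial_def)

lemma partial_coord: "partial i (\<lambda>z. z $ k) z = (if i = k then 1 else 0)"
  unfolding partial_def
  by (rule DERIV_imp_deriv) (auto intro!: derivative_eq_intros simp: axis_def)

lemma partial_vec_graph:
  "partial_vec 1 (graph_param f) z = vector [1, 0, partial 1 f z]"
  "partial_vec 2 (graph_param f) z = vector [0, 1, partial 2 f z]"
  by (simp_all add: partial_vec_def graph_param_def vec_eq_iff forall_3 vector_3 partial_coord)

lemma partial_vec_partial_vec_graph:
  "partial_vec i (partial_vec j (graph_param f)) z = vector [0, 0, partial i (partial j f) z]"
proof -
  have "j = 1 \<or> j = 2"
    using exhaust_2 by blast
  then have "partial_vec j (graph_param f) =
      (\<lambda>z. vector [if j = 1 then 1 else 0, if j = 1 then 0 else 1, partial j f z])"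
    using partial_vec_graph[of f] by auto
  then show ?thesis
    by (simp add: partial_vec_def vec_eq_iff forall_3 vector_3 partial_vec_graph)
qed

lemma area_w_pos: "area_w f z > 0"
  by (simp add: area_w_def add_pos_nonneg)

lemma area_w_sq: "(area_w f z)\<^sup>2 = 1 + (slope_p f z)\<^sup>2 + (slope_q f z)\<^sup>2"
  by (simp add: area_w_def)

lemma induced_metric_nth:
  "induced_metric f z $ 1 $ 1 = 1 + (slope_p f z)\<^sup>2"
  "induced_metric f z $ 1 $ 2 = slope_p f z * slope_q f z"
  "induced_metric f z $ 2 $ 1 = slope_p f z * slope_q f z"
  "induced_metric f z $ 2 $ 2 = 1 + (slope_q f z)\<^sup>2"
  by (simp_all add: induced_metric_def partial_vec_graph heis_inner_def heis_form_def
      graph_param_def vector_3 slope_p_def slope_q_def power2_eq_square)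
    (simp_all add: algebra_simps)

lemma det_induced_metric: "det (induced_metric f z) = (area_w f z)\<^sup>2"
  using area_w_sq[of f z]
  by (simp add: det_2 induced_metric_nth power2_eq_square algebra_simps)

lemma matrix_inv_unique:
  fixes A B :: "real ^ 'n ^ 'n"
  assumes "A ** B = mat 1"
  shows "matrix_inv A = B"
proof -
  have BA: "B ** A = mat 1"
    using assms matrix_left_right_inverse by blast
  have "A ** matrix_inv A = mat 1"
    unfolding matrix_inv_def by (rule someI2[of _ B]) (use assms BA in auto)
  then have "B ** (A ** matrix_inv A) = B"
    by simp
  then show ?thesis
    by (simp add: matrix_mul_assoc BA)
qed

lemma matrix_inv_2:
  fixes A :: "real ^ 2 ^ 2"
  assumes "det A \<noteq> 0"
  shows "matrix_inv A = (1 / det A) *\<^sub>R vector [vector [A$2$2, - A$1$2], vector [- A$2$1, A$1$1]]"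
proof (rule matrix_inv_unique)
  let ?B = "(1 / det A) *\<^sub>R vector [vector [A$2$2, - A$1$2], vector [- A$2$1, A$1$1]] :: real ^ 2 ^ 2"
  have B: "?B $ 1 $ 1 = A$2$2 / det A" "?B $ 1 $ 2 = - A$1$2 / det A"
    "?B $ 2 $ 1 = - A$2$1 / det A" "?B $ 2 $ 2 = A$1$1 / det A"
    by simp_all
  have "A$1$1 * A$2$2 / det A - A$1$2 * A$2$1 / det A = 1"
    using assms by (simp add: diff_divide_distrib[symmetric] det_2)
  then show "A ** ?B = mat 1"
    unfolding vec_eq_iff forall_2 matrix_matrix_mult_def
    by (simp add: sum_2 B mat_def del: vector_scaleR_component) (simp add: algebra_simps)
qed

lemma unit_normal_eq:
  "unit_normal f z = (1 / area_w f z) *\<^sub>R vector [- slope_p f z, - slope_q f z,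
     1 + slope_p f z * z$2 / 2 - slope_q f z * z$1 / 2]" (is "_ = ?N")
proof -
  let ?p = "slope_p f z" and ?q = "slope_q f z" and ?w = "area_w f z"
  let ?P = "graph_param f z"
  have w: "?w > 0" "?w * ?w = 1 + ?p * ?p + ?q * ?q"
    using area_w_pos area_w_sq[of f z] by (simp_all add: power2_eq_square)
  have form: "heis_form ?P ?N = 1 / ?w"
    using w by (simp add: heis_form_def graph_param_def vector_3 field_simps)
  have formX: "heis_form ?P (partial_vec 1 (graph_param f) z) = ?p"
    "heis_form ?P (partial_vec 2 (graph_param f) z) = ?q"
    by (simp_all add: heis_form_def graph_param_def vector_3 partial_vec_graph slope_p_def slope_q_def)
  have form3: "heis_form ?P (axis 3 1) = 1"
    by (simp add: heis_form_def axis_def)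
  show ?thesis
    unfolding unit_normal_def
  proof (rule the_equality, intro conjI)
    have "heis_inner ?P ?N ?N = (?p * ?p + ?q * ?q + 1) / (?w * ?w)"
      unfolding heis_inner_def form by (simp add: vector_3 add_divide_distrib)
    also have "?p * ?p + ?q * ?q + 1 = ?w * ?w"
      using w(2) by simp
    finally show "heis_inner ?P ?N ?N = 1"
      using w(1) by simp
    show "\<forall>i. heis_inner ?P ?N (partial_vec i (graph_param f) z) = 0"
      unfolding forall_2 heis_inner_def form formX by (simp add: vector_3 partial_vec_graph)
    show "heis_inner ?P ?N (axis 3 1) > 0"
      unfolding heis_inner_def form form3 using w by (simp add: axis_def)
  next
    fix N
    assume N: "heis_inner ?P N N = 1 \<and>
      (\<forall>i. heis_inner ?P N (partial_vec i (graph_param f) z) = 0) \<and>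
      heis_inner ?P N (axis 3 1) > 0"
    define t where "t = heis_form ?P N"
    have t: "t > 0"
      using N unfolding heis_inner_def form3 t_def by (simp add: axis_def)
    have "heis_inner ?P N (partial_vec 1 (graph_param f) z) = 0"
      "heis_inner ?P N (partial_vec 2 (graph_param f) z) = 0"
      using N by auto
    then have N12: "N$1 = - t * ?p" "N$2 = - t * ?q"
      unfolding heis_inner_def formX t_def[symmetric] by (simp_all add: vector_3 partial_vec_graph)
    have "(t * ?w)\<^sup>2 = t * t * (?w * ?w)"
      by (simp add: power2_eq_square)
    also have "\<dots> = heis_inner ?P N N"
      unfolding heis_inner_def t_def[symmetric] N12 w(2) by (simp add: algebra_simps)
    also have "\<dots> = 1\<^sup>2"
      using N by simp
    finally have "t * ?w = 1"
      using t w(1) by (intro power2_eq_imp_eq[of "t * ?w" 1]) auto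
    then have tw: "t = 1 / ?w"
      using w by (simp add: field_simps)
    have "t = z$2 * N$1 / 2 - z$1 * N$2 / 2 + N$3"
      unfolding t_def by (simp add: heis_form_def graph_param_def vector_3)
    then have "N$3 = t - z$2 * (- t * ?p) / 2 + z$1 * (- t * ?q) / 2"
      unfolding N12 by linarith
    also have "\<dots> = t * (1 + ?p * z$2 / 2 - ?q * z$1 / 2)"
      by (simp add: algebra_simps)
    finally show "N = ?N"
      by (simp add: vec_eq_iff forall_3 vector_3 N12 tw)
  qed
qed

lemma left_translate_to_id_eq:
  "left_translate_to_id P V = vector [V$1, V$2, V$3 - (P$1 * V$2 - P$2 * V$1) / 2]"
proof -
  let ?L = "\<lambda>V::real^3. vector [V$1, V$2, V$3 - (P$1 * V$2 - P$2 * V$1) / 2] :: real^3"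
  have "linear ?L"
    by (rule linearI) (simp_all add: vec_eq_iff forall_3 vector_3 field_simps)
  then have "bounded_linear ?L"
    by (simp add: linear_conv_bounded_linear)
  then have "((\<lambda>Q. ?L Q + (- P)) has_derivative (\<lambda>V. ?L V + 0)) (at P)"
    by (intro has_derivative_add bounded_linear_imp_has_derivative has_derivative_const)
  moreover have "heis_mult (heis_inv P) = (\<lambda>Q. ?L Q + (- P))"
    by (rule ext) (simp add: heis_mult_def heis_inv_def vec_eq_iff forall_3 vector_3 field_simps)
  ultimately have "(heis_mult (heis_inv P) has_derivative ?L) (at P)"
    by (simp only: add_0_right)
  from frechet_derivative_at[OF this, symmetric] show ?thesis
    by (simp only: left_translate_to_id_def)
qed

lemma gauss_map_eq: "gauss_map f z = vector [- slope_p f z, - slope_q f z]"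
proof -
  have "area_w f z \<noteq> 0"
    using area_w_pos[of f z] by simp
  then show ?thesis
    by (simp add: gauss_map_def left_translate_to_id_eq unit_normal_eq central_proj_def graph_param_def
        vec_eq_iff forall_2 vector_3 field_simps)
qed

lemma heis_metric_eq:
  "heis_metric P = vector
    [vector [1 + P$2 * P$2 / 4, - P$1 * P$2 / 4, P$2 / 2],
     vector [- P$1 * P$2 / 4, 1 + P$1 * P$1 / 4, - P$1 / 2],
     vector [P$2 / 2, - P$1 / 2, 1]]"
  by (simp add: heis_metric_def heis_inner_def heis_form_def axis_def vec_eq_iff forall_3 vector_3 field_simps)

lemma matrix_inv_heis_metric:
  "matrix_inv (heis_metric P) = vector
    [vector [1, 0, - P$2 / 2],
     vector [0, 1, P$1 / 2],
     vector [- P$2 / 2, P$1 / 2, 1 + P$1 * P$1 / 4 + P$2 * P$2 / 4]]"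
  by (rule matrix_inv_unique)
    (simp add: heis_metric_eq matrix_matrix_mult_def vec_eq_iff forall_3 vector_3 sum_3 mat_def field_simps)

lemma partial_heis_metric:
  "partial b (\<lambda>P. heis_metric P $ d $ c) P = (vector
    [vector [P$2 / 2 * axis b 1 $ 2, - (axis b 1 $ 1 * P$2 + P$1 * axis b 1 $ 2) / 4, axis b 1 $ 2 / 2],
     vector [- (axis b 1 $ 1 * P$2 + P$1 * axis b 1 $ 2) / 4, P$1 / 2 * axis b 1 $ 1, - axis b 1 $ 1 / 2],
     vector [axis b 1 $ 2 / 2, - axis b 1 $ 1 / 2, 0]] :: real ^ 3 ^ 3) $ d $ c"
  (is "_ = ?D $ d $ c")
proof -
  have "\<forall>d c. ((\<lambda>t. heis_metric (P + t *\<^sub>R axis b 1) $ d $ c) has_field_derivative ?D $ d $ c) (at 0)"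
    unfolding forall_3 heis_metric_eq vector_3
    by (auto intro!: derivative_eq_intros simp: field_simps)
  then show ?thesis
    unfolding partial_def by (blast intro: DERIV_imp_deriv)
qed

lemma christoffel_heis_metric:
  "christoffel heis_metric a b c P = (vector
    [vector
      [vector [0, P$2 / 4, 0], vector [P$2 / 4, - P$1 / 2, 1 / 2], vector [0, 1 / 2, 0]],
     vector
      [vector [- P$2 / 2, P$1 / 4, - 1 / 2], vector [P$1 / 4, 0, 0], vector [- 1 / 2, 0, 0]],
     vector
      [vector [- P$1 * P$2 / 4, (P$1 * P$1 - P$2 * P$2) / 8, - P$1 / 4],
       vector [(P$1 * P$1 - P$2 * P$2) / 8, P$1 * P$2 / 4, - P$2 / 4],
       vector [- P$1 / 4, - P$2 / 4, 0]]] :: real ^ 3 ^ 3 ^ 3) $ a $ b $ c" (is "_ = ?G $ a $ b $ c")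
proof -
  have "\<forall>a b c. christoffel heis_metric a b c P = ?G $ a $ b $ c"
    unfolding forall_3 christoffel_def partial_heis_metric matrix_inv_heis_metric
    by (simp add: sum_3 axis_def vector_3 field_simps)
  then show ?thesis
    by blast
qed

lemma heis_inner_unit_normal:
  "heis_inner (graph_param f z) V (unit_normal f z) =
    (heis_form (graph_param f z) V - slope_p f z * V$1 - slope_q f z * V$2) / area_w f z"
proof -
  have "area_w f z \<noteq> 0"
    using area_w_pos[of f z] by simp
  then have form: "heis_form (graph_param f z) (unit_normal f z) = 1 / area_w f z"
    by (simp add: unit_normal_eq heis_form_def graph_param_def vector_3 field_simps)
  have "unit_normal f z $ 1 = - slope_p f z / area_w f z"
    "unit_normal f z $ 2 = - slope_q f z / area_w f z"
    by (simp_all add: unit_normal_eq vector_3)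
  then show ?thesis
    unfolding heis_inner_def form by (simp add: diff_divide_distrib mult.commute)
qed

lemma second_fundamental_form_eq:
  "heis_inner (graph_param f z) (cov_deriv f 1 1 z) (unit_normal f z) =
    (partial 1 (partial 1 f) z + slope_p f z * slope_q f z) / area_w f z"
  "heis_inner (graph_param f z) (cov_deriv f 1 2 z) (unit_normal f z) =
    (partial 1 (partial 2 f) z + ((slope_q f z)\<^sup>2 - (slope_p f z)\<^sup>2) / 2) / area_w f z"
  "heis_inner (graph_param f z) (cov_deriv f 2 1 z) (unit_normal f z) =
    (partial 2 (partial 1 f) z + ((slope_q f z)\<^sup>2 - (slope_p f z)\<^sup>2) / 2) / area_w f z"
  "heis_inner (graph_param f z) (cov_deriv f 2 2 z) (unit_normal f z) =
    (partial 2 (partial 2 f) z - slope_p f z * slope_q f z) / area_w f z"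
  unfolding heis_inner_unit_normal
  by (rule arg_cong2[where f = "(/)"],
    simp add: cov_deriv_def partial_vec_partial_vec_graph partial_vec_graph christoffel_heis_metric
      sum_3 vector_3 heis_form_def graph_param_def slope_p_def slope_q_def power2_eq_square,
    simp add: field_simps, rule refl)+

lemma mean_curvature_eq:
  assumes sym: "partial 2 (partial 1 f) z = partial 1 (partial 2 f) z"
  shows "2 * mean_curvature f z =
    ((1 + (slope_q f z)\<^sup>2) * partial 1 (partial 1 f) z
      - 2 * slope_p f z * slope_q f z * partial 1 (partial 2 f) z
      + (1 + (slope_p f z)\<^sup>2) * partial 2 (partial 2 f) z) / (area_w f z) ^ 3"
proof -
  have w: "area_w f z \<noteq> 0"
    using area_w_pos[of f z] by simp
  then have "det (induced_metric f z) \<noteq> 0"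
    by (simp add: det_induced_metric)
  note inv = matrix_inv_2[OF this, unfolded det_induced_metric induced_metric_nth]
  have inv_nth: "matrix_inv (induced_metric f z) $ 1 $ 1 = (1 + (slope_q f z)\<^sup>2) / (area_w f z)\<^sup>2"
    "matrix_inv (induced_metric f z) $ 1 $ 2 = - (slope_p f z * slope_q f z) / (area_w f z)\<^sup>2"
    "matrix_inv (induced_metric f z) $ 2 $ 1 = - (slope_p f z * slope_q f z) / (area_w f z)\<^sup>2"
    "matrix_inv (induced_metric f z) $ 2 $ 2 = (1 + (slope_p f z)\<^sup>2) / (area_w f z)\<^sup>2"
    unfolding inv by simp_all
  have *: "(1 + q\<^sup>2) / w\<^sup>2 * ((a + p * q) / w) + - (p * q) / w\<^sup>2 * ((b + (q\<^sup>2 - p\<^sup>2) / 2) / w) +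
      (- (p * q) / w\<^sup>2 * ((b + (q\<^sup>2 - p\<^sup>2) / 2) / w) + (1 + p\<^sup>2) / w\<^sup>2 * ((c - p * q) / w)) =
      ((1 + q\<^sup>2) * a - 2 * p * q * b + (1 + p\<^sup>2) * c) / w ^ 3" for p q a b c w :: real
  proof -
    have "(1 + q\<^sup>2) * (a + p * q) - p * q * (b + (q\<^sup>2 - p\<^sup>2) / 2) +
        (- (p * q) * (b + (q\<^sup>2 - p\<^sup>2) / 2) + (1 + p\<^sup>2) * (c - p * q)) =
        (1 + q\<^sup>2) * a - 2 * p * q * b + (1 + p\<^sup>2) * c"
      by (simp add: field_simps power2_eq_square)
    moreover have "w ^ 3 = w\<^sup>2 * w"
      by (simp add: power3_eq_cube power2_eq_square)
    ultimately show ?thesis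
      by (simp add: add_divide_distrib[symmetric] diff_divide_distrib[symmetric])
  qed
  have half: "2 * (1 / 2 * c) = c" for c :: real
    by simp
  show ?thesis
    unfolding mean_curvature_def sum_2 second_fundamental_form_eq inv_nth sym * half ..
qed

end

theory Submission
  imports Defs
begin

text \<open>
  Let \<open>n = (p, q)\<close> be the slope vector, so that the Gauss map is \<open>\<phi> = - n\<close>, and let
  \<open>N = n / w\<close> be the normalized slope vector. Two facts make the tension field computable.

  The first concerns the target. The Gans model is the upper sheet of the hyperboloid
  \<open>s\<^sup>2 = 1 + u\<^sup>2 + v\<^sup>2\<close> in Minkowski space, seen from above, and the position vector
  is a unit normal of the hyperboloid. The Gauss formula therefore reads
  \<open>\<Gamma>\<^sup>\<alpha>\<^sub>\<beta>\<^sub>\<gamma> = - \<phi>\<^sup>\<alpha> h\<^sub>\<beta>\<^sub>\<gamma>\<close> (\<open>christoffel_gans_metric\<close>), and the tension field of a map into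
  the Gans model is its Laplacian minus \<open>\<phi>\<close> times the trace of the pulled back metric
  (\<open>tension_gans_metric\<close>).

  The second concerns the graph. The slope vector is not a gradient, but its curl
  \<open>p\<^sub>y - q\<^sub>x\<close> is the constant 1 (\<open>slope_curl\<close>). With \<open>A = w g\<^sup>-\<^sup>1\<close>, the matrix of the
  divergence form of the Laplacian, one has \<open>w\<^sup>2 \<partial>\<^sub>k N = A \<partial>\<^sub>k n\<close> (\<open>partial_normal\<close>).
  For a gradient \<open>n\<close> this would give \<open>(A \<nabla>n\<^sub>k)\<^sub>i = w\<^sup>2 \<partial>\<^sub>k N\<^sub>i\<close>;
  here it holds up to an entry of \<open>A\<close>. Since \<open>2 H = div N\<close> (\<open>mean_curvature_divergence\<close>),
  taking the divergence and commuting the derivatives yields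
  \<open>w \<Delta>n\<^sub>k = 2 w\<^sup>2 \<partial>\<^sub>k H\<close> plus terms without second derivatives of \<open>n\<close>
  (\<open>laplace_slope\<close>). This accounts for the term \<open>2 w \<partial>\<^sub>k H\<close> of the theorem.

  What remains is an identity between rational functions of \<open>p\<close>, \<open>q\<close>, \<open>w\<close> and the first
  derivatives of \<open>n\<close>. After multiplication by \<open>w\<^sup>4\<close> it is polynomial, and it
  follows from \<open>w\<^sup>2 = 1 + p\<^sup>2 + q\<^sup>2\<close> and \<open>p\<^sub>y = q\<^sub>x + 1\<close> alone.

  The only analytic ingredient is the symmetry of mixed partial derivatives
  (\<open>partial_commute\<close>), used for \<open>f\<close> in the curl equation and for the components of \<open>N\<close> in
  the Laplacian.
\<close>

section \<open>Calculus of partial derivatives\<close>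

lemma has_field_derivative_along_axis:
  fixes F :: "real ^ 'n \<Rightarrow> real"
  assumes "(F has_derivative D) (at (a + t *\<^sub>R axis i 1))"
  shows "((\<lambda>s. F (a + s *\<^sub>R axis i 1)) has_field_derivative D (axis i 1)) (at t)"
proof -
  have "((\<lambda>s. a + s *\<^sub>R axis i 1) has_derivative (\<lambda>s. s *\<^sub>R axis i 1)) (at t)"
    by (auto intro!: derivative_eq_intros)
  from has_derivative_compose[OF this assms]
  have "((\<lambda>s. F (a + s *\<^sub>R axis i 1)) has_derivative (\<lambda>s. D (s *\<^sub>R axis i 1))) (at t)" .
  moreover have "D (s *\<^sub>R axis i 1) = D (axis i 1) * s" for s
    using linear_scale[OF has_derivative_linear[OF assms]] by simp
  ultimately show ?thesis
    by (simp add: has_field_derivative_def)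
qed

lemma partial_eq_has_derivative:
  fixes F :: "real ^ 'n \<Rightarrow> real"
  assumes "(F has_derivative D) (at z)"
  shows "partial i F z = D (axis i 1)"
  unfolding partial_def by (rule DERIV_imp_deriv) (use has_field_derivative_along_axis[of F D z 0 i] assms in simp)

lemma has_partial_along:
  fixes F :: "real ^ 'n \<Rightarrow> real"
  assumes "F differentiable (at (a + t *\<^sub>R axis i 1))"
  shows "((\<lambda>s. F (a + s *\<^sub>R axis i 1)) has_field_derivative partial i F (a + t *\<^sub>R axis i 1)) (at t)"
  using assms has_field_derivative_along_axis partial_eq_has_derivative unfolding differentiable_def by metis

lemma has_partial:
  fixes F :: "real ^ 'n \<Rightarrow> real"
  assumes "F differentiable (at z)"
  shows "((\<lambda>s. F (z + s *\<^sub>R axis i 1)) has_field_derivative partial i F z) (at 0)"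
  using has_partial_along[of F z 0 i] assms by simp

lemma partial_cong_open:
  fixes F G :: "real ^ 'n \<Rightarrow> real"
  assumes "open S" "z \<in> S" "\<And>x. x \<in> S \<Longrightarrow> F x = G x"
  shows "partial i F z = partial i G z"
proof -
  have "((\<lambda>t. z + t *\<^sub>R axis i 1) \<longlongrightarrow> z + 0 *\<^sub>R axis i 1) (nhds (0::real))"
    by (intro tendsto_intros filterlim_ident)
  then have "\<forall>\<^sub>F t in nhds 0. z + t *\<^sub>R axis i 1 \<in> S"
    using assms(1,2) by (auto dest: topological_tendstoD)
  then have "\<forall>\<^sub>F t in nhds 0. F (z + t *\<^sub>R axis i 1) = G (z + t *\<^sub>R axis i 1)"
    by eventually_elim (rule assms(3))
  then show ?thesis
    unfolding partial_def by (intro deriv_cong_ev) auto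
qed

lemma differentiable_cong_open:
  assumes "open S" "z \<in> S" "\<And>x. x \<in> S \<Longrightarrow> F x = G x" "F differentiable (at z)"
  shows "G differentiable (at z)"
  using assms has_derivative_transform_within_open unfolding differentiable_def by metis

lemma differentiable_coord: "(\<lambda>z::real^'n. z $ k) differentiable (at z)"
  by (intro bounded_linear_imp_differentiable bounded_linear_vec_nth)

lemma differentiable_sqrt:
  fixes F :: "'a::real_normed_vector \<Rightarrow> real"
  assumes "F differentiable (at z)" "F z > 0"
  shows "(\<lambda>x. sqrt (F x)) differentiable (at z)"
  using assms unfolding differentiable_def by (blast intro: has_derivative_real_sqrt)

lemma partial_add:
  assumes "F differentiable (at z)" "G differentiable (at z)"
  shows "partial i (\<lambda>x. F x + G x) z = partial i F z + partial i G z"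
  unfolding partial_def[of i "\<lambda>x. F x + G x"]
  by (intro DERIV_imp_deriv DERIV_add has_partial assms)

lemma partial_diff:
  assumes "F differentiable (at z)" "G differentiable (at z)"
  shows "partial i (\<lambda>x. F x - G x) z = partial i F z - partial i G z"
  unfolding partial_def[of i "\<lambda>x. F x - G x"]
  by (intro DERIV_imp_deriv DERIV_diff has_partial assms)

lemma partial_minus:
  assumes "F differentiable (at z)"
  shows "partial i (\<lambda>x. - F x) z = - partial i F z"
  unfolding partial_def[of i "\<lambda>x. - F x"]
  by (intro DERIV_imp_deriv DERIV_minus has_partial assms)

lemma partial_mult:
  assumes "F differentiable (at z)" "G differentiable (at z)"
  shows "partial i (\<lambda>x. F x * G x) z = partial i F z * G z + F z * partial i G z"
  unfolding partial_def[of i "\<lambda>x. F x * G x"]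
  by (rule DERIV_imp_deriv) (use DERIV_mult[OF has_partial[OF assms(1)] has_partial[OF assms(2)]] in \<open>simp add: mult.commute add.commute\<close>)

lemma partial_divide:
  assumes "F differentiable (at z)" "G differentiable (at z)" "G z \<noteq> 0"
  shows "partial i (\<lambda>x. F x / G x) z = (partial i F z * G z - F z * partial i G z) / (G z)\<^sup>2"
  unfolding partial_def[of i "\<lambda>x. F x / G x"]
  by (rule DERIV_imp_deriv) (use DERIV_divide[OF has_partial[OF assms(1)] has_partial[OF assms(2)]] assms(3) in \<open>simp add: power2_eq_square\<close>)

lemma partial_power2:
  assumes "F differentiable (at z)"
  shows "partial i (\<lambda>x. (F x)\<^sup>2) z = 2 * F z * partial i F z"
  unfolding power2_eq_square by (simp add: partial_mult assms)

section \<open>Symmetry of mixed partial derivatives\<close>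

text \<open>
  By the mean value theorem in the direction \<open>i\<close>, the second difference is \<open>h\<close> times a
  difference of values of \<open>partial i F\<close> at two points whose distance is \<open>h\<close> in the
  direction \<open>j\<close>. Both points have distance at most \<open>2 h\<close> from \<open>z\<close>, so the derivative of
  \<open>partial i F\<close> at \<open>z\<close> controls this difference up to \<open>o(h)\<close>.
\<close>
lemma second_difference_quotient_tendsto:
  fixes F :: "real ^ 'n \<Rightarrow> real"
  assumes S: "open S" "z \<in> S"
    and F: "\<And>x. x \<in> S \<Longrightarrow> F differentiable (at x)"
    and G: "partial i F differentiable (at z)"
  shows "((\<lambda>h. (F (z + h *\<^sub>R axis i 1 + h *\<^sub>R axis j 1) - F (z + h *\<^sub>R axis i 1)
      - F (z + h *\<^sub>R axis j 1) + F z) / h\<^sup>2) \<longlongrightarrow> partial j (partial i F) z) (at_right 0)"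
proof (rule tendstoI)
  fix e :: real
  assume e: "e > 0"
  let ?G = "partial i F" and ?a = "axis i 1 :: real ^ 'n" and ?b = "axis j 1 :: real ^ 'n"
  obtain L where L: "(?G has_derivative L) (at z)"
    using G by (auto simp: differentiable_def)
  have lin: "linear L"
    using L has_derivative_linear by blast
  \<comment> \<open>The two points lie within \<open>2 h\<close> and \<open>h\<close> of \<open>z\<close>, so \<open>e / 4\<close> gives a total error of \<open>3 / 4 * e * h\<close>.\<close>
  from L e obtain d where d: "d > 0"
    "\<And>x. norm (x - z) < d \<Longrightarrow> norm (?G x - ?G z - L (x - z)) \<le> e / 4 * norm (x - z)"
    unfolding has_derivative_at_alt by (meson divide_pos_pos zero_less_numeral)
  from S obtain c where c: "c > 0" "ball z c \<subseteq> S"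
    by (auto simp: open_contains_ball)
  have "\<forall>\<^sub>F h in at_right 0. 0 < h \<and> h < min c d / 2"
    using c d by (intro eventually_conj eventually_at_right_less eventually_at_right_field[THEN iffD2])
      (auto intro!: exI[of _ "min c d / 2"])
  then show "\<forall>\<^sub>F h in at_right 0. dist ((F (z + h *\<^sub>R ?a + h *\<^sub>R ?b) - F (z + h *\<^sub>R ?a)
      - F (z + h *\<^sub>R ?b) + F z) / h\<^sup>2) (partial j ?G z) < e"
  proof eventually_elim
    fix h :: real
    assume "0 < h \<and> h < min c d / 2"
    then have h: "0 < h" "2 * h < c" "2 * h < d"
      by auto
    have n1: "norm (t *\<^sub>R ?a + h *\<^sub>R ?b) \<le> 2 * h" if "0 \<le> t" "t \<le> h" for t
      using norm_triangle_ineq[of "t *\<^sub>R ?a" "h *\<^sub>R ?b"] that h(1) by simp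
    have n2: "norm (t *\<^sub>R ?a) \<le> h" if "0 \<le> t" "t \<le> h" for t
      using that h(1) by simp
    define \<phi> where "\<phi> t = F ((z + h *\<^sub>R ?b) + t *\<^sub>R ?a) - F (z + t *\<^sub>R ?a)" for t
    have "DERIV \<phi> t :> ?G ((z + h *\<^sub>R ?b) + t *\<^sub>R ?a) - ?G (z + t *\<^sub>R ?a)"
      if t: "0 \<le> t" "t \<le> h" for t
    proof -
      have "z + h *\<^sub>R ?b + t *\<^sub>R ?a \<in> S" "z + t *\<^sub>R ?a \<in> S"
        using n1[OF t] n2[OF t] h by (auto intro!: subsetD[OF c(2)] simp: dist_norm norm_minus_commute add_ac
          simp del: norm_scaleR)
      then show ?thesis
        unfolding \<phi>_def by (intro DERIV_diff has_partial_along F)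
    qed
    from MVT2[OF h(1) this] obtain \<xi> where \<xi>: "0 < \<xi>" "\<xi> < h"
      "\<phi> h - \<phi> 0 = (h - 0) * (?G ((z + h *\<^sub>R ?b) + \<xi> *\<^sub>R ?a) - ?G (z + \<xi> *\<^sub>R ?a))"
      by blast
    let ?u = "\<xi> *\<^sub>R ?a + h *\<^sub>R ?b" and ?v = "\<xi> *\<^sub>R ?a"
    have u: "norm ?u \<le> 2 * h" and v: "norm ?v \<le> h"
      using n1 n2 \<xi> by (meson less_imp_le)+
    have "\<bar>?G (z + ?u) - ?G z - L ?u\<bar> \<le> e / 4 * norm ?u"
      using d(2)[of "z + ?u"] u h by simp
    also have "\<dots> \<le> e / 4 * (2 * h)"
      using u e by (intro mult_left_mono) auto
    finally have 1: "\<bar>?G (z + ?u) - ?G z - L ?u\<bar> \<le> e / 4 * (2 * h)" .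
    have "\<bar>?G (z + ?v) - ?G z - L ?v\<bar> \<le> e / 4 * norm ?v"
      using d(2)[of "z + ?v"] v h by simp
    also have "\<dots> \<le> e / 4 * h"
      using v e by (intro mult_left_mono) auto
    finally have 2: "\<bar>?G (z + ?v) - ?G z - L ?v\<bar> \<le> e / 4 * h" .
    have Lu: "L ?u = L ?v + h * L ?b"
      by (simp add: linear_add[OF lin] linear_scale[OF lin])
    \<comment> \<open>The unknown intermediate point \<open>\<xi>\<close> drops out of the difference.\<close>
    have "\<bar>?G (z + ?u) - ?G (z + ?v) - h * L ?b\<bar> \<le> 3 / 4 * e * h"
      using 1 2 unfolding Lu by linarith
    then have "\<bar>?G (z + ?u) - ?G (z + ?v) - h * L ?b\<bar> / h \<le> 3 / 4 * e"
      using h(1) by (simp add: field_simps)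
    also have "\<bar>?G (z + ?u) - ?G (z + ?v) - h * L ?b\<bar> / h = \<bar>(?G (z + ?u) - ?G (z + ?v)) / h - L ?b\<bar>"
      using h(1) abs_divide[of "?G (z + ?u) - ?G (z + ?v) - h * L ?b" h]
      by (simp add: diff_divide_distrib)
    finally have "\<bar>(?G (z + ?u) - ?G (z + ?v)) / h - L ?b\<bar> < e"
      using e by linarith
    moreover have "(F (z + h *\<^sub>R ?a + h *\<^sub>R ?b) - F (z + h *\<^sub>R ?a) - F (z + h *\<^sub>R ?b) + F z) / h\<^sup>2
        = (\<phi> h - \<phi> 0) / h\<^sup>2"
      by (simp add: \<phi>_def add_ac)
    moreover have "\<dots> = (?G (z + ?u) - ?G (z + ?v)) / h"
      unfolding \<xi>(3) using h(1) by (simp add: power2_eq_square add_ac)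
    ultimately show "dist ((F (z + h *\<^sub>R ?a + h *\<^sub>R ?b) - F (z + h *\<^sub>R ?a)
        - F (z + h *\<^sub>R ?b) + F z) / h\<^sup>2) (partial j ?G z) < e"
      by (simp add: dist_real_def partial_eq_has_derivative[OF L])
  qed
qed

text \<open>
  The second difference is symmetric in the two directions, and each order of differentiation
  is a limit of its quotient by \<open>h\<^sup>2\<close>. The hypotheses are differentiability statements
  because for an explicit quotient such as \<open>q / w\<close> these follow from the differentiation
  rules.
\<close>
lemma partial_commute:
  fixes F :: "real ^ 'n \<Rightarrow> real"
  assumes "open S" "z \<in> S" "\<And>x. x \<in> S \<Longrightarrow> F differentiable (at x)"
    and "partial i F differentiable (at z)" "partial j F differentiable (at z)"
  shows "partial i (partial j F) z = partial j (partial i F) z"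
proof -
  have eq: "(\<lambda>h. (F (z + h *\<^sub>R axis j 1 + h *\<^sub>R axis i 1) - F (z + h *\<^sub>R axis j 1)
      - F (z + h *\<^sub>R axis i 1) + F z) / h\<^sup>2) = (\<lambda>h. (F (z + h *\<^sub>R axis i 1 + h *\<^sub>R axis j 1)
      - F (z + h *\<^sub>R axis i 1) - F (z + h *\<^sub>R axis j 1) + F z) / h\<^sup>2)"
    by (simp add: fun_eq_iff add_ac diff_diff_eq)
  show ?thesis
    using tendsto_unique[OF _ second_difference_quotient_tendsto[OF assms(1-3,5), of i, unfolded eq]
        second_difference_quotient_tendsto[OF assms(1-4), of j]]
    by simp
qed

text \<open>Three orders of differentiation are needed for the Laplacian of the slopes.\<close>
lemma smooth_on_differentiable:
  assumes "open S" "smooth_on S F" "z \<in> S"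
  shows "F differentiable (at z)" and "partial i F differentiable (at z)"
    and "partial j (partial i F) differentiable (at z)"
proof -
  have "Ck_on (Suc (Suc (Suc 0))) S F"
    using assms(2) by (auto simp only: smooth_on_def)
  then have "F differentiable_on S \<and> partial i F differentiable_on S
      \<and> partial j (partial i F) differentiable_on S"
    by simp
  then show "F differentiable (at z)" "partial i F differentiable (at z)"
    "partial j (partial i F) differentiable (at z)"
    using assms(1,3) by (auto simp: differentiable_on_eq_differentiable_at)
qed

section \<open>Maps into the Gans model\<close>

text \<open>
  The metric is induced from Minkowski space by the embedding
  \<open>(u, v) \<mapsto> (u, v, sqrt (1 + u\<^sup>2 + v\<^sup>2))\<close>. The first two components are linear in the
  coordinates, so their second derivatives vanish, while by the Gauss formula for the
  hyperboloid they equal \<open>\<Gamma>\<^sup>a\<^sub>b\<^sub>c + z\<^sup>a h\<^sub>b\<^sub>c\<close>. In coordinates this is a direct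
  calculation.
\<close>
lemma christoffel_gans_metric:
  "christoffel gans_metric a b c z = - z $ a * gans_metric z $ b $ c"
proof -
  let ?d = "\<lambda>z::real^2. 1 + (z $ 1)\<^sup>2 + (z $ 2)\<^sup>2"
  have pos: "?d z > 0" for z :: "real^2"
    by (simp add: add_pos_nonneg)
  have nz: "?d z \<noteq> 0" for z :: "real^2"
    using pos[of z] by simp
  have "(1 + (z$2)\<^sup>2) * (1 + (z$1)\<^sup>2) - (z$1 * z$2) * (z$1 * z$2) = ?d z"
    by (simp add: algebra_simps power2_eq_square)
  then have "det (gans_metric z) = ?d z / (?d z * ?d z)"
    by (simp add: det_2 gans_metric_nth diff_divide_distrib[symmetric])
  then have det: "det (gans_metric z) = 1 / ?d z"
    using nz[of z] by simp
  then have "det (gans_metric z) \<noteq> 0"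
    using nz by simp
  note inv = matrix_inv_2[OF this, unfolded det gans_metric_nth]
  have inv: "matrix_inv (gans_metric z) $ 1 $ 1 = 1 + (z$1)\<^sup>2"
    "matrix_inv (gans_metric z) $ 1 $ 2 = z$1 * z$2"
    "matrix_inv (gans_metric z) $ 2 $ 1 = z$1 * z$2"
    "matrix_inv (gans_metric z) $ 2 $ 2 = 1 + (z$2)\<^sup>2"
    unfolding inv using nz[of z] by simp_all
  have "\<forall>a b c. christoffel gans_metric a b c z = - z $ a * gans_metric z $ b $ c"
    unfolding forall_2 christoffel_def sum_2 inv gans_metric_nth
    using nz[of z] pos[of z]
    by (simp add: partial_divide partial_mult partial_add partial_minus partial_power2
        differentiable_coord partial_coord nz)
      (simp add: divide_simps, simp add: algebra_simps power2_eq_square)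
  then show ?thesis
    by blast
qed

text \<open>Twice the energy density of \<open>\<phi>\<close>, that is, the trace of \<open>\<phi>\<^sup>*h\<close> with respect to \<open>g\<close>.\<close>
definition pullback_trace ::
  "'n::finite metric \<Rightarrow> 'm::finite metric \<Rightarrow> (real ^ 'n \<Rightarrow> real ^ 'm) \<Rightarrow> real ^ 'n \<Rightarrow> real" where
  "pullback_trace g h \<phi> z = (\<Sum>i\<in>UNIV. \<Sum>j\<in>UNIV. \<Sum>\<beta>\<in>UNIV. \<Sum>\<gamma>\<in>UNIV.
     h (\<phi> z) $ \<beta> $ \<gamma> * partial i (\<lambda>z'. \<phi> z' $ \<beta>) z * partial j (\<lambda>z'. \<phi> z' $ \<gamma>) z *
     matrix_inv (g z) $ i $ j)"

lemma tension_gans_metric: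
  "tension g gans_metric \<phi> z $ \<alpha> =
    laplace g (\<lambda>z'. \<phi> z' $ \<alpha>) z - \<phi> z $ \<alpha> * pullback_trace g gans_metric \<phi> z"
  by (simp add: tension_def pullback_trace_def christoffel_gans_metric sum_distrib_left sum_negf mult.assoc)

section \<open>Metric quantities of a graph\<close>

lemma matrix_inv_induced_metric:
  "matrix_inv (induced_metric f z) $ 1 $ 1 = (1 + (slope_q f z)\<^sup>2) / (area_w f z)\<^sup>2"
  "matrix_inv (induced_metric f z) $ 1 $ 2 = - (slope_p f z * slope_q f z) / (area_w f z)\<^sup>2"
  "matrix_inv (induced_metric f z) $ 2 $ 1 = - (slope_p f z * slope_q f z) / (area_w f z)\<^sup>2"
  "matrix_inv (induced_metric f z) $ 2 $ 2 = (1 + (slope_p f z)\<^sup>2) / (area_w f z)\<^sup>2"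
proof -
  have "det (induced_metric f z) \<noteq> 0"
    using area_w_pos[of f z] by (simp add: det_induced_metric)
  note inv = matrix_inv_2[OF this, unfolded det_induced_metric induced_metric_nth]
  show "matrix_inv (induced_metric f z) $ 1 $ 1 = (1 + (slope_q f z)\<^sup>2) / (area_w f z)\<^sup>2"
    "matrix_inv (induced_metric f z) $ 1 $ 2 = - (slope_p f z * slope_q f z) / (area_w f z)\<^sup>2"
    "matrix_inv (induced_metric f z) $ 2 $ 1 = - (slope_p f z * slope_q f z) / (area_w f z)\<^sup>2"
    "matrix_inv (induced_metric f z) $ 2 $ 2 = (1 + (slope_p f z)\<^sup>2) / (area_w f z)\<^sup>2"
    unfolding inv by simp_all
qed

text \<open>
  The entries of \<open>w g\<^sup>-\<^sup>1 = sqrt (det g) g\<^sup>-\<^sup>1\<close>, which sends the gradient of a function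
  to the flux whose divergence is \<open>w\<close> times its Laplacian.
\<close>
definition flux11 where "flux11 f z = (1 + (slope_q f z)\<^sup>2) / area_w f z"
definition flux12 where "flux12 f z = - (slope_p f z * slope_q f z) / area_w f z"
definition flux22 where "flux22 f z = (1 + (slope_p f z)\<^sup>2) / area_w f z"

lemma laplace_induced_metric:
  "laplace (induced_metric f) \<psi> z = 1 / area_w f z *
    (partial 1 (\<lambda>z'. flux11 f z' * partial 1 \<psi> z') z + partial 1 (\<lambda>z'. flux12 f z' * partial 2 \<psi> z') z
     + partial 2 (\<lambda>z'. flux12 f z' * partial 1 \<psi> z') z + partial 2 (\<lambda>z'. flux22 f z' * partial 2 \<psi> z') z)"
proof -
  have w: "sqrt (det (induced_metric f z)) = area_w f z" for z
    using area_w_pos[of f z] by (simp add: det_induced_metric)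
  have c: "area_w f z * (t / (area_w f z)\<^sup>2) = t / area_w f z" for t z
    using area_w_pos[of f z] by (simp add: power2_eq_square)
  show ?thesis
    unfolding laplace_def sum_2 w matrix_inv_induced_metric c flux11_def flux12_def flux22_def
    by (simp add: add.assoc)
qed

text \<open>
  The horizontal components of the left-translated unit normal, with the opposite sign.
\<close>
definition normal_p where "normal_p f z = slope_p f z / area_w f z"
definition normal_q where "normal_q f z = slope_q f z / area_w f z"

text \<open>
  Along the Gauss map the matrix of the Gans metric coincides with \<open>g\<^sup>-\<^sup>1\<close>, so both
  metrics contribute a factor \<open>1 / w\<^sup>2\<close>. Multiplication by \<open>w\<^sup>4\<close> leaves a polynomial in
  the slopes and their first derivatives.
\<close>
lemma pullback_trace_gauss_map:
  fixes f z
  defines "p \<equiv> slope_p f z" and "q \<equiv> slope_q f z"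
  defines "D i \<equiv> partial i (slope_p f) z" and "E i \<equiv> partial i (slope_q f) z"
  assumes d: "slope_p f differentiable (at z)" "slope_q f differentiable (at z)"
  shows "(area_w f z) ^ 4 * pullback_trace (induced_metric f) gans_metric (gauss_map f) z =
      (1 + q\<^sup>2) * ((1 + q\<^sup>2) * (D 1)\<^sup>2 - 2 * p * q * D 1 * D 2 + (1 + p\<^sup>2) * (D 2)\<^sup>2)
      - 2 * p * q * ((1 + q\<^sup>2) * D 1 * E 1 - p * q * (D 1 * E 2 + D 2 * E 1) + (1 + p\<^sup>2) * D 2 * E 2)
      + (1 + p\<^sup>2) * ((1 + q\<^sup>2) * (E 1)\<^sup>2 - 2 * p * q * E 1 * E 2 + (1 + p\<^sup>2) * (E 2)\<^sup>2)"
proof -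
  have w: "area_w f z > 0"
    by (rule area_w_pos)
  have "(area_w f z)\<^sup>2 = 1 + p\<^sup>2 + q\<^sup>2"
    by (simp add: area_w_sq p_def q_def)
  then have h: "gans_metric (gauss_map f z) $ 1 $ 1 = (1 + q\<^sup>2) / (area_w f z)\<^sup>2"
    "gans_metric (gauss_map f z) $ 1 $ 2 = - (p * q) / (area_w f z)\<^sup>2"
    "gans_metric (gauss_map f z) $ 2 $ 1 = - (p * q) / (area_w f z)\<^sup>2"
    "gans_metric (gauss_map f z) $ 2 $ 2 = (1 + p\<^sup>2) / (area_w f z)\<^sup>2"
    unfolding gans_metric_nth by (simp_all add: gauss_map_eq p_def q_def)
  have D: "partial i (\<lambda>z. gauss_map f z $ 1) z = - D i"
    "partial i (\<lambda>z. gauss_map f z $ 2) z = - E i" for i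
    by (simp_all add: gauss_map_eq partial_minus d D_def E_def)
  have c: "(area_w f z) ^ 4 * (h / (area_w f z)\<^sup>2 * s * t * (g / (area_w f z)\<^sup>2)) = h * s * t * g"
    for h s t g :: real
    using w by (simp add: field_simps power2_eq_square power4_eq_xxxx)
  show ?thesis
    unfolding pullback_trace_def sum_2 distrib_left h D
      matrix_inv_induced_metric[of f z, folded p_def q_def] c
    by algebra
qed

section \<open>First derivatives of the normal\<close>

context
  fixes \<Omega> :: "(real ^ 2) set" and f :: "real ^ 2 \<Rightarrow> real"
  assumes open_domain: "open \<Omega>" and smooth: "smooth_on \<Omega> f"
begin

lemma slope_differentiable:
  assumes "z \<in> \<Omega>"
  shows "slope_p f differentiable (at z)" "slope_q f differentiable (at z)"
  unfolding slope_p_def[abs_def] slope_q_def[abs_def]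
  by (intro derivative_intros differentiable_coord smooth_on_differentiable[OF open_domain smooth assms] zero_neq_numeral not_sym[OF zero_neq_numeral])+

lemma partial_slope:
  assumes "z \<in> \<Omega>"
  shows "partial 1 (slope_p f) z = partial 1 (partial 1 f) z"
    "partial 2 (slope_p f) z = partial 2 (partial 1 f) z + 1/2"
    "partial 1 (slope_q f) z = partial 1 (partial 2 f) z - 1/2"
    "partial 2 (slope_q f) z = partial 2 (partial 2 f) z"
  unfolding slope_p_def[abs_def] slope_q_def[abs_def]
  by (simp_all add: partial_add partial_diff partial_divide partial_coord differentiable_coord
      smooth_on_differentiable[OF open_domain smooth assms])

lemma partial_slope_differentiable:
  assumes "z \<in> \<Omega>"
  shows "partial i (slope_p f) differentiable (at z)" "partial i (slope_q f) differentiable (at z)"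
proof -
  note d = smooth_on_differentiable(3)[OF open_domain smooth assms]
  have "i = 1 \<or> i = 2"
    using exhaust_2 by blast
  then show "partial i (slope_p f) differentiable (at z)"
    using differentiable_cong_open[OF open_domain assms partial_slope(1)[symmetric] d]
      differentiable_cong_open[OF open_domain assms partial_slope(2)[symmetric]
        differentiable_add[OF d differentiable_const]]
    by auto
  show "partial i (slope_q f) differentiable (at z)"
    using \<open>i = 1 \<or> i = 2\<close> differentiable_cong_open[OF open_domain assms partial_slope(4)[symmetric] d]
      differentiable_cong_open[OF open_domain assms partial_slope(3)[symmetric]
        differentiable_diff[OF d differentiable_const]]
    by auto
qed

text \<open>
  The second derivatives of \<open>f\<close> cancel; the constant comes from the terms \<open>y / 2\<close> and
  \<open>- x / 2\<close> in the slopes, that is, from the non-integrability of the horizontal planes.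
\<close>
lemma slope_curl:
  assumes "z \<in> \<Omega>"
  shows "partial 2 (slope_p f) z = partial 1 (slope_q f) z + 1"
proof -
  note d = smooth_on_differentiable[OF open_domain smooth]
  have "partial 2 (partial 1 f) z = partial 1 (partial 2 f) z"
    by (rule partial_commute[OF open_domain assms d(1) d(2)[OF assms] d(2)[OF assms]])
  then show ?thesis
    by (simp add: partial_slope assms)
qed

lemma area_differentiable:
  assumes "z \<in> \<Omega>"
  shows "area_w f differentiable (at z)"
  unfolding area_w_def[abs_def]
  by (intro differentiable_sqrt derivative_intros slope_differentiable assms) (simp add: add_pos_nonneg)

lemma partial_area:
  assumes "z \<in> \<Omega>"
  shows "partial k (area_w f) z =
    (slope_p f z * partial k (slope_p f) z + slope_q f z * partial k (slope_q f) z) / area_w f z"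
proof -
  note d = area_differentiable[OF assms] slope_differentiable[OF assms]
  \<comment> \<open>Differentiating \<open>w\<^sup>2\<close> avoids the square root.\<close>
  have "partial k (\<lambda>z. (area_w f z)\<^sup>2) z = partial k (\<lambda>z. 1 + (slope_p f z)\<^sup>2 + (slope_q f z)\<^sup>2) z"
    by (simp add: area_w_sq)
  then have "2 * area_w f z * partial k (area_w f) z =
      2 * slope_p f z * partial k (slope_p f) z + 2 * slope_q f z * partial k (slope_q f) z"
    by (simp add: partial_power2 partial_add d)
  then show ?thesis
    using area_w_pos[of f z] by (simp add: field_simps)
qed

lemma normal_differentiable:
  assumes "z \<in> \<Omega>"
  shows "normal_p f differentiable (at z)" "normal_q f differentiable (at z)"
  unfolding normal_p_def[abs_def] normal_q_def[abs_def]
  using area_w_pos[of f z]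
  by (auto intro!: differentiable_divide slope_differentiable area_differentiable assms)

text \<open>
  Differentiating \<open>n / w\<close> gives \<open>(w\<^sup>2 I - n n\<^sup>T) \<partial>\<^sub>k n / w\<^sup>3\<close>, and
  \<open>w\<^sup>2 I - n n\<^sup>T\<close> is the adjugate of \<open>g\<close>: the map \<open>n \<mapsto> n / w\<close> and the metric \<open>g\<close>
  involve the same matrix.
\<close>
lemma partial_normal:
  assumes "z \<in> \<Omega>"
  shows "(area_w f z)\<^sup>2 * partial k (normal_p f) z =
      flux11 f z * partial k (slope_p f) z + flux12 f z * partial k (slope_q f) z"
    "(area_w f z)\<^sup>2 * partial k (normal_q f) z =
      flux12 f z * partial k (slope_p f) z + flux22 f z * partial k (slope_q f) z"
proof -
  note d = area_differentiable[OF assms] slope_differentiable[OF assms]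
  define a b w where "a = partial k (slope_p f) z" "b = partial k (slope_q f) z" "w = area_w f z"
  note abw = a_b_w_def
  define p q where "p = slope_p f z" "q = slope_q f z"
  note pq = p_q_def
  have w: "w > 0" "w * w = 1 + p\<^sup>2 + q\<^sup>2"
    using area_w_pos area_w_sq[of f z] by (auto simp: abw pq power2_eq_square)
  have 1: "(area_w f z)\<^sup>2 * partial k (normal_p f) z = a * w - p * ((p * a + q * b) / w)"
    "(area_w f z)\<^sup>2 * partial k (normal_q f) z = b * w - q * ((p * a + q * b) / w)"
    unfolding normal_p_def[abs_def] normal_q_def[abs_def]
    using w(1) by (simp_all add: partial_divide d partial_area assms abw pq)
  \<comment> \<open>Brings both terms over the common denominator \<open>w\<close>, with the numerator free of \<open>w\<close>.\<close>
  have 2: "t * w = t * (1 + p\<^sup>2 + q\<^sup>2) / w" for t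
    unfolding w(2)[symmetric] using w(1) by simp
  show "(area_w f z)\<^sup>2 * partial k (normal_p f) z =
      flux11 f z * partial k (slope_p f) z + flux12 f z * partial k (slope_q f) z"
    unfolding 1 unfolding 2 flux11_def flux12_def abw[symmetric] pq[symmetric] using w(1)
    by (simp add: field_simps power2_eq_square)
  show "(area_w f z)\<^sup>2 * partial k (normal_q f) z =
      flux12 f z * partial k (slope_p f) z + flux22 f z * partial k (slope_q f) z"
    unfolding 1 unfolding 2 flux22_def flux12_def abw[symmetric] pq[symmetric] using w(1)
    by (simp add: field_simps power2_eq_square)
qed

lemma flux_differentiable:
  assumes "z \<in> \<Omega>"
  shows "flux11 f differentiable (at z)" "flux12 f differentiable (at z)" "flux22 f differentiable (at z)"
  unfolding flux11_def[abs_def] flux12_def[abs_def] flux22_def[abs_def]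
  using area_w_pos[of f z]
  by (auto intro!: derivative_intros slope_differentiable area_differentiable assms)

text \<open>This makes \<open>partial_commute\<close> applicable to the components of the normal.\<close>
lemma partial_normal_differentiable:
  assumes "z \<in> \<Omega>"
  shows "partial k (normal_p f) differentiable (at z)" "partial k (normal_q f) differentiable (at z)"
proof -
  have P: "partial k (normal_p f) z =
      (flux11 f z * partial k (slope_p f) z + flux12 f z * partial k (slope_q f) z) / (area_w f z)\<^sup>2"
    and Q: "partial k (normal_q f) z =
      (flux12 f z * partial k (slope_p f) z + flux22 f z * partial k (slope_q f) z) / (area_w f z)\<^sup>2"
    if "z \<in> \<Omega>" for z
    using partial_normal[OF that, of k] area_w_pos[of f z] by (auto simp: eq_divide_eq mult.commute)
  have w: "(area_w f z)\<^sup>2 \<noteq> 0"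
    using area_w_pos[of f z] by simp
  note d = area_differentiable[OF assms] flux_differentiable[OF assms] partial_slope_differentiable[OF assms]
  show "partial k (normal_p f) differentiable (at z)"
    by (rule differentiable_cong_open[OF open_domain assms P[symmetric]])
      (use w in \<open>auto intro!: derivative_intros d\<close>)
  show "partial k (normal_q f) differentiable (at z)"
    by (rule differentiable_cong_open[OF open_domain assms Q[symmetric]])
      (use w in \<open>auto intro!: derivative_intros d\<close>)
qed

section \<open>Mean curvature and the Laplacian of the slopes\<close>

text \<open>
  The mixed entry of \<open>A\<close> multiplies \<open>p\<^sub>y + q\<^sub>x\<close>, in which the contributions \<open>1 / 2\<close> and
  \<open>- 1 / 2\<close> of the group structure cancel. The divergence of \<open>N\<close> is therefore the same
  combination of second derivatives of \<open>f\<close> as the mean curvature.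
\<close>
lemma mean_curvature_divergence:
  assumes "z \<in> \<Omega>"
  shows "2 * mean_curvature f z = partial 1 (normal_p f) z + partial 2 (normal_q f) z"
proof -
  have w: "area_w f z > 0"
    using area_w_pos by blast
  have sym: "partial 2 (partial 1 f) z = partial 1 (partial 2 f) z"
    using slope_curl[OF assms] by (simp add: partial_slope assms)
  have "(area_w f z)\<^sup>2 * (partial 1 (normal_p f) z + partial 2 (normal_q f) z) =
     ((1 + (slope_q f z)\<^sup>2) * partial 1 (partial 1 f) z
      - 2 * slope_p f z * slope_q f z * partial 1 (partial 2 f) z
      + (1 + (slope_p f z)\<^sup>2) * partial 2 (partial 2 f) z) / area_w f z"
    unfolding distrib_left partial_normal[OF assms] partial_slope[OF assms] sym flux11_def flux12_def flux22_def
    using w by (simp add: field_simps)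
  then show ?thesis
    unfolding mean_curvature_eq[OF sym] using w
    by (simp add: power3_eq_cube power2_eq_square field_simps)
qed

text \<open>
  The order of differentiation is chosen so that the right-hand side is the divergence of
  \<open>\<partial>\<^sub>k N\<close>, the form in which it appears in the Laplacian of the slopes.
\<close>
lemma partial_mean_curvature:
  assumes "z \<in> \<Omega>"
  shows "2 * partial 1 (mean_curvature f) z =
      partial 1 (partial 1 (normal_p f)) z + partial 2 (partial 1 (normal_q f)) z"
    "2 * partial 2 (mean_curvature f) z =
      partial 1 (partial 2 (normal_p f)) z + partial 2 (partial 2 (normal_q f)) z"
proof -
  note d = normal_differentiable partial_normal_differentiable[OF assms]
  have H: "2 * partial k (mean_curvature f) z =
      partial k (partial 1 (normal_p f)) z + partial k (partial 2 (normal_q f)) z" for k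
  proof -
    have "partial k (mean_curvature f) z =
        partial k (\<lambda>z. (partial 1 (normal_p f) z + partial 2 (normal_q f) z) / 2) z"
      by (rule partial_cong_open[OF open_domain assms]) (simp flip: mean_curvature_divergence)
    then show ?thesis
      by (simp add: partial_divide partial_add d)
  qed
  have P: "partial 2 (partial 1 (normal_p f)) z = partial 1 (partial 2 (normal_p f)) z"
    by (rule partial_commute[OF open_domain assms d(1,3,3)])
  have Q: "partial 1 (partial 2 (normal_q f)) z = partial 2 (partial 1 (normal_q f)) z"
    by (rule partial_commute[OF open_domain assms d(2,4,4)])
  show "2 * partial 1 (mean_curvature f) z =
      partial 1 (partial 1 (normal_p f)) z + partial 2 (partial 1 (normal_q f)) z"
    "2 * partial 2 (mean_curvature f) z =
      partial 1 (partial 2 (normal_p f)) z + partial 2 (partial 2 (normal_q f)) z"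
    unfolding H P Q by simp_all
qed

text \<open>
  The flux of \<open>n\<^sub>k\<close> has components \<open>\<Sum>\<^sub>j A\<^sup>i\<^sup>j \<partial>\<^sub>j n\<^sub>k\<close>. Exchanging the
  indices \<open>j\<close> and \<open>k\<close> by the curl equation turns it into \<open>w\<^sup>2 \<partial>\<^sub>k N\<^sub>i\<close> plus or minus
  a single entry of \<open>A\<close>, because \<open>\<Sum>\<^sub>j A\<^sup>i\<^sup>j \<partial>\<^sub>k n\<^sub>j = w\<^sup>2 \<partial>\<^sub>k N\<^sub>i\<close>. The divergence of
  \<open>w\<^sup>2 \<partial>\<^sub>k N\<close> contains \<open>w\<^sup>2\<close> times the derivative of \<open>div N = 2 H\<close>; no other term has second
  derivatives of the slopes.
\<close>
lemma laplace_slope: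
  assumes z: "z \<in> \<Omega>"
  shows "area_w f z * laplace (induced_metric f) (slope_p f) z =
      2 * (area_w f z)\<^sup>2 * partial 1 (mean_curvature f) z
      + 2 * area_w f z * (partial 1 (area_w f) z * partial 1 (normal_p f) z
          + partial 2 (area_w f) z * partial 1 (normal_q f) z)
      + partial 1 (flux12 f) z + partial 2 (flux22 f) z" (is ?P)
    "area_w f z * laplace (induced_metric f) (slope_q f) z =
      2 * (area_w f z)\<^sup>2 * partial 2 (mean_curvature f) z
      + 2 * area_w f z * (partial 1 (area_w f) z * partial 2 (normal_p f) z
          + partial 2 (area_w f) z * partial 2 (normal_q f) z)
      - partial 1 (flux11 f) z - partial 2 (flux12 f) z" (is ?Q)
proof -
  note d = area_differentiable[OF z] flux_differentiable[OF z] partial_slope_differentiable[OF z]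
    normal_differentiable[OF z] partial_normal_differentiable[OF z]
  have div: "area_w f z * laplace (induced_metric f) \<psi> z =
      partial 1 (\<lambda>z. flux11 f z * partial 1 \<psi> z + flux12 f z * partial 2 \<psi> z) z
      + partial 2 (\<lambda>z. flux12 f z * partial 1 \<psi> z + flux22 f z * partial 2 \<psi> z) z"
    if "\<And>k. partial k \<psi> differentiable (at z)" for \<psi>
    using area_w_pos[of f z] by (simp add: laplace_induced_metric partial_add that d)
  have "partial 1 (\<lambda>z. flux11 f z * partial 1 (slope_p f) z + flux12 f z * partial 2 (slope_p f) z) z
      = partial 1 (\<lambda>z. (area_w f z)\<^sup>2 * partial 1 (normal_p f) z + flux12 f z) z"
    by (rule partial_cong_open[OF open_domain z]) ((simp only: partial_normal slope_curl), simp add: algebra_simps)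
  moreover have "partial 2 (\<lambda>z. flux12 f z * partial 1 (slope_p f) z + flux22 f z * partial 2 (slope_p f) z) z
      = partial 2 (\<lambda>z. (area_w f z)\<^sup>2 * partial 1 (normal_q f) z + flux22 f z) z"
    by (rule partial_cong_open[OF open_domain z]) ((simp only: partial_normal slope_curl), simp add: algebra_simps)
  ultimately have "area_w f z * laplace (induced_metric f) (slope_p f) z =
      (area_w f z)\<^sup>2 * (2 * partial 1 (mean_curvature f) z)
      + 2 * area_w f z * (partial 1 (area_w f) z * partial 1 (normal_p f) z
          + partial 2 (area_w f) z * partial 1 (normal_q f) z)
      + partial 1 (flux12 f) z + partial 2 (flux22 f) z"
    unfolding partial_mean_curvature[OF z] div[OF d(5)]
    by (simp add: partial_add partial_mult partial_power2 d algebra_simps)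
  then show ?P
    by (simp add: mult_ac)
  have "partial 1 (\<lambda>z. flux11 f z * partial 1 (slope_q f) z + flux12 f z * partial 2 (slope_q f) z) z
      = partial 1 (\<lambda>z. (area_w f z)\<^sup>2 * partial 2 (normal_p f) z - flux11 f z) z"
    by (rule partial_cong_open[OF open_domain z]) ((simp only: partial_normal slope_curl), simp add: algebra_simps)
  moreover have "partial 2 (\<lambda>z. flux12 f z * partial 1 (slope_q f) z + flux22 f z * partial 2 (slope_q f) z) z
      = partial 2 (\<lambda>z. (area_w f z)\<^sup>2 * partial 2 (normal_q f) z - flux12 f z) z"
    by (rule partial_cong_open[OF open_domain z]) ((simp only: partial_normal slope_curl), simp add: algebra_simps)
  ultimately have "area_w f z * laplace (induced_metric f) (slope_q f) z =
      (area_w f z)\<^sup>2 * (2 * partial 2 (mean_curvature f) z)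
      + 2 * area_w f z * (partial 1 (area_w f) z * partial 2 (normal_p f) z
          + partial 2 (area_w f) z * partial 2 (normal_q f) z)
      - partial 1 (flux11 f) z - partial 2 (flux12 f) z"
    unfolding partial_mean_curvature[OF z] div[OF d(6)]
    by (simp add: partial_diff partial_mult partial_power2 d algebra_simps)
  then show ?Q
    by (simp add: mult_ac)
qed

section \<open>The tension field of the Gauss map\<close>

text \<open>
  The partial derivatives of \<open>\<psi>\<close> are differentiated once more, so the sign has to be extracted
  in a neighbourhood of \<open>z\<close>; hence the differentiability of \<open>\<psi>\<close> on the whole domain.
\<close>
lemma laplace_minus:
  assumes z: "z \<in> \<Omega>" and "\<And>x. x \<in> \<Omega> \<Longrightarrow> \<psi> differentiable (at x)"
    and d: "\<And>k. partial k \<psi> differentiable (at z)"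
  shows "laplace (induced_metric f) (\<lambda>z. - \<psi> z) z = - laplace (induced_metric f) \<psi> z"
proof -
  have "partial i (\<lambda>z. A z * partial j (\<lambda>z. - \<psi> z) z) z = - partial i (\<lambda>z. A z * partial j \<psi> z) z"
    if "A differentiable (at z)" for A i j
  proof -
    have "partial i (\<lambda>z. A z * partial j (\<lambda>z. - \<psi> z) z) z = partial i (\<lambda>z. - (A z * partial j \<psi> z)) z"
      by (rule partial_cong_open[OF open_domain z]) (simp add: partial_minus assms(2))
    then show ?thesis
      by (simp add: partial_minus d that)
  qed
  then show ?thesis
    by (simp add: laplace_induced_metric flux_differentiable[OF z] algebra_simps)
qed

text \<open>The factor \<open>w\<^sup>3\<close> clears the denominators, in preparation for a polynomial identity.\<close>
lemma partial_flux:
  assumes z: "z \<in> \<Omega>"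
  defines "p \<equiv> slope_p f z" and "q \<equiv> slope_q f z" and "w \<equiv> area_w f z"
  shows "w ^ 3 * partial k (flux11 f) z = 2 * q * partial k (slope_q f) z * w\<^sup>2
      - (1 + q\<^sup>2) * (p * partial k (slope_p f) z + q * partial k (slope_q f) z)"
    "w ^ 3 * partial k (flux12 f) z = - (partial k (slope_p f) z * q + p * partial k (slope_q f) z) * w\<^sup>2
      + p * q * (p * partial k (slope_p f) z + q * partial k (slope_q f) z)"
    "w ^ 3 * partial k (flux22 f) z = 2 * p * partial k (slope_p f) z * w\<^sup>2
      - (1 + p\<^sup>2) * (p * partial k (slope_p f) z + q * partial k (slope_q f) z)"
proof -
  note d = area_differentiable[OF z] slope_differentiable[OF z]
  have w: "w > 0"
    unfolding w_def by (rule area_w_pos)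
  have c: "w ^ 3 * ((s * w - t * (u / w)) / w\<^sup>2) = s * w\<^sup>2 - t * u" for s t u
    using w by (simp add: field_simps power2_eq_square power3_eq_cube)
  note rules = partial_divide partial_minus partial_add partial_mult partial_power2 d
    partial_area[OF z]
  show "w ^ 3 * partial k (flux11 f) z = 2 * q * partial k (slope_q f) z * w\<^sup>2
      - (1 + q\<^sup>2) * (p * partial k (slope_p f) z + q * partial k (slope_q f) z)"
    using w c[of "2 * q * partial k (slope_q f) z" "1 + q\<^sup>2"] unfolding flux11_def[abs_def]
    by (simp add: rules flip: p_def q_def w_def)
  show "w ^ 3 * partial k (flux12 f) z = - (partial k (slope_p f) z * q + p * partial k (slope_q f) z) * w\<^sup>2
      + p * q * (p * partial k (slope_p f) z + q * partial k (slope_q f) z)"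
  proof -
    have "partial k (flux12 f) z = - (((partial k (slope_p f) z * q + p * partial k (slope_q f) z) * w
        - p * q * ((p * partial k (slope_p f) z + q * partial k (slope_q f) z) / w)) / w\<^sup>2)"
      using w unfolding flux12_def[abs_def] by (simp add: rules flip: p_def q_def w_def)
    then show ?thesis
      by (simp only: mult_minus_right c)
  qed
  show "w ^ 3 * partial k (flux22 f) z = 2 * p * partial k (slope_p f) z * w\<^sup>2
      - (1 + p\<^sup>2) * (p * partial k (slope_p f) z + q * partial k (slope_q f) z)"
    using w c[of "2 * p * partial k (slope_p f) z" "1 + p\<^sup>2"] unfolding flux22_def[abs_def]
    by (simp add: rules flip: p_def q_def w_def)
qed

text \<open>
  The term \<open>2 w \<partial>\<^sub>k H\<close> cancels against the Laplacian. Every other term is a polynomial in the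
  slopes and their first derivatives divided by \<open>w\<^sup>4\<close>; multiplied by \<open>w\<^sup>4\<close>, both sides
  become \<open>\<nu> (\<plusminus> n\<^sub>l - 2 w \<partial>\<^sub>k w + n\<^sub>k \<nu>)\<close>, where \<open>\<nu> = 2 w\<^sup>3 H\<close> is the numerator of the mean
  curvature and \<open>n\<^sub>l\<close> is the other slope.
\<close>
lemma tension_gauss_map:
  assumes z: "z \<in> \<Omega>"
  defines "p \<equiv> slope_p f z" and "q \<equiv> slope_q f z" and "w \<equiv> area_w f z" and "H \<equiv> mean_curvature f z"
  defines "\<tau> \<equiv> tension (induced_metric f) gans_metric (gauss_map f) z"
  shows "\<tau> $ 1 + 2 * w * partial 1 (mean_curvature f) z =
      H * (2 * q / w - 4 * partial 1 (area_w f) z + 4 * p * H * w\<^sup>2)" (is ?P)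
    "\<tau> $ 2 + 2 * w * partial 2 (mean_curvature f) z =
      H * (- 2 * p / w - 4 * partial 2 (area_w f) z + 4 * q * H * w\<^sup>2)" (is ?Q)
proof -
  note d = slope_differentiable partial_slope_differentiable[OF z]
  define Lp Lq E where "Lp = laplace (induced_metric f) (slope_p f) z"
    and "Lq = laplace (induced_metric f) (slope_q f) z"
    and "E = pullback_trace (induced_metric f) gans_metric (gauss_map f) z"
  define a b c where "a = partial 1 (slope_p f) z" and "b = partial 1 (slope_q f) z"
    and "c = partial 2 (slope_q f) z"
  have py: "partial 2 (slope_p f) z = b + 1"
    unfolding b_def by (rule slope_curl[OF z])
  have w: "w > 0"
    unfolding w_def by (rule area_w_pos)
  have W: "w\<^sup>2 = 1 + p\<^sup>2 + q\<^sup>2"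
    unfolding w_def p_def q_def by (rule area_w_sq)
  have gauss: "gauss_map f z $ 1 = - slope_p f z" "gauss_map f z $ 2 = - slope_q f z" for z
    by (simp_all add: gauss_map_eq)
  have tau: "\<tau> $ 1 = - Lp + p * E" "\<tau> $ 2 = - Lq + q * E"
    unfolding \<tau>_def tension_gans_metric gauss
    by (simp_all add: laplace_minus[OF z] d Lp_def Lq_def E_def p_def q_def)
  note defs = a_def[symmetric] b_def[symmetric] c_def[symmetric] p_def[symmetric] q_def[symmetric] w_def[symmetric]
  define X Y where "X = p * a + q * b" and "Y = p * (b + 1) + q * c"
  have dw: "w * partial 1 (area_w f) z = X" "w * partial 2 (area_w f) z = Y"
    unfolding partial_area[OF z] py defs X_def Y_def using w by simp_all
  have normal: "w ^ 3 * partial k (normal_p f) z = (1 + q\<^sup>2) * partial k (slope_p f) z - p * q * partial k (slope_q f) z"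
      "w ^ 3 * partial k (normal_q f) z = (1 + p\<^sup>2) * partial k (slope_q f) z - p * q * partial k (slope_p f) z" for k
  proof -
    have cube: "w ^ 3 * t = w * (w\<^sup>2 * t)" for t
      by (simp add: power3_eq_cube power2_eq_square)
    note normal = partial_normal[OF z, of k, unfolded flux11_def flux12_def flux22_def defs]
    show "w ^ 3 * partial k (normal_p f) z = (1 + q\<^sup>2) * partial k (slope_p f) z - p * q * partial k (slope_q f) z"
      "w ^ 3 * partial k (normal_q f) z = (1 + p\<^sup>2) * partial k (slope_q f) z - p * q * partial k (slope_p f) z"
      unfolding cube normal using w by (simp_all add: field_simps)
  qed
  define \<nu> where "\<nu> = (1 + q\<^sup>2) * a - p * q * (2 * b + 1) + (1 + p\<^sup>2) * c"
  have H: "2 * w ^ 3 * H = \<nu>"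
    using mean_curvature_divergence[OF z] normal(1)[of 1] normal(2)[of 2]
    unfolding H_def[symmetric] py defs \<nu>_def by algebra
  have E: "w ^ 4 * E = (1 + q\<^sup>2) * ((1 + q\<^sup>2) * a\<^sup>2 - 2 * p * q * a * (b + 1) + (1 + p\<^sup>2) * (b + 1)\<^sup>2)
      - 2 * p * q * ((1 + q\<^sup>2) * a * b - p * q * (a * c + (b + 1) * b) + (1 + p\<^sup>2) * (b + 1) * c)
      + (1 + p\<^sup>2) * ((1 + q\<^sup>2) * b\<^sup>2 - 2 * p * q * b * c + (1 + p\<^sup>2) * c\<^sup>2)"
    using pullback_trace_gauss_map[OF d(1,2)[OF z]] unfolding py defs E_def .
  note flux = partial_flux[OF z, unfolded defs]
  have rhs: "w ^ 4 * (H * (2 * s / w - 4 * v + 4 * t * H * w\<^sup>2)) = \<nu> * (s - 2 * (w * v) + t * \<nu>)" for s v t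
    unfolding H[symmetric] using w by (simp add: field_simps power2_eq_square power3_eq_cube power4_eq_xxxx)
  have "w ^ 4 * (\<tau> $ 1 + 2 * w * partial 1 (mean_curvature f) z) =
      w ^ 4 * (H * (2 * q / w - 4 * partial 1 (area_w f) z + 4 * p * H * w\<^sup>2))"
  proof -
    have "w * (w ^ 3 * (Lp - 2 * w * partial 1 (mean_curvature f) z)) =
        2 * X * (w ^ 3 * partial 1 (normal_p f) z) + 2 * Y * (w ^ 3 * partial 1 (normal_q f) z)
        + w ^ 3 * partial 1 (flux12 f) z + w ^ 3 * partial 2 (flux22 f) z"
      using laplace_slope(1)[OF z]
      unfolding Lp_def[symmetric] dw[symmetric] defs by algebra
    then have "w ^ 4 * (\<tau> $ 1 + 2 * w * partial 1 (mean_curvature f) z) = p * (w ^ 4 * E)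
        - (2 * X * (w ^ 3 * partial 1 (normal_p f) z) + 2 * Y * (w ^ 3 * partial 1 (normal_q f) z)
        + w ^ 3 * partial 1 (flux12 f) z + w ^ 3 * partial 2 (flux22 f) z)"
      unfolding tau by algebra
    \<comment> \<open>A polynomial identity in \<open>p\<close>, \<open>q\<close>, \<open>a\<close>, \<open>b\<close>, \<open>c\<close>, as the curl equation has eliminated the fourth derivative.\<close>
    also have "\<dots> = \<nu> * (q - 2 * X + p * \<nu>)"
      unfolding E normal flux py defs W X_def Y_def \<nu>_def by algebra
    finally show ?thesis
      unfolding rhs dw .
  qed
  then show ?P
    using w by simp
  have "w ^ 4 * (\<tau> $ 2 + 2 * w * partial 2 (mean_curvature f) z) =
      w ^ 4 * (H * (2 * (- p) / w - 4 * partial 2 (area_w f) z + 4 * q * H * w\<^sup>2))"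
  proof -
    have "w * (w ^ 3 * (Lq - 2 * w * partial 2 (mean_curvature f) z)) =
        2 * X * (w ^ 3 * partial 2 (normal_p f) z) + 2 * Y * (w ^ 3 * partial 2 (normal_q f) z)
        - w ^ 3 * partial 1 (flux11 f) z - w ^ 3 * partial 2 (flux12 f) z"
      using laplace_slope(2)[OF z]
      unfolding Lq_def[symmetric] dw[symmetric] defs by algebra
    then have "w ^ 4 * (\<tau> $ 2 + 2 * w * partial 2 (mean_curvature f) z) = q * (w ^ 4 * E)
        - (2 * X * (w ^ 3 * partial 2 (normal_p f) z) + 2 * Y * (w ^ 3 * partial 2 (normal_q f) z)
        - w ^ 3 * partial 1 (flux11 f) z - w ^ 3 * partial 2 (flux12 f) z)"
      unfolding tau by algebra
    also have "\<dots> = \<nu> * (- p - 2 * Y + q * \<nu>)"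
      unfolding E normal flux py defs W X_def Y_def \<nu>_def by algebra
    finally show ?thesis
      unfolding rhs dw .
  qed
  then show ?Q
    using w by simp
qed

end

theorem theorem5:
  fixes \<Omega> :: "(real ^ 2) set" and f :: "real ^ 2 \<Rightarrow> real"
  assumes "open \<Omega>" and "smooth_on \<Omega> f"
  shows "\<forall>z\<in>\<Omega>.
    let x = z $ 1; y = z $ 2;
        fx = partial 1 f z; fy = partial 2 f z;
        w = (\<lambda>z'. sqrt (1 + (partial 1 f z' + z' $ 2 / 2)\<^sup>2 + (partial 2 f z' - z' $ 1 / 2)\<^sup>2));
        H = mean_curvature f;
        \<tau> = tension (induced_metric f) gans_metric (gauss_map f) z
    in \<tau> $ 1 + 2 * w z * partial 1 H z =
         H z * (2 * (fy - x / 2) / w z - 4 * partial 1 w z + 4 * (fx + y / 2) * H z * (w z)\<^sup>2)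
     \<and> \<tau> $ 2 + 2 * w z * partial 2 H z =
         H z * (- 2 * (fx + y / 2) / w z - 4 * partial 2 w z + 4 * (fy - x / 2) * H z * (w z)\<^sup>2)"
proof
  fix z
  assume z: "z \<in> \<Omega>"
  have w: "(\<lambda>z'. sqrt (1 + (partial 1 f z' + z' $ 2 / 2)\<^sup>2 + (partial 2 f z' - z' $ 1 / 2)\<^sup>2)) = area_w f"
    by (simp add: area_w_def[abs_def] slope_p_def slope_q_def)
  show "let x = z $ 1; y = z $ 2;
        fx = partial 1 f z; fy = partial 2 f z;
        w = (\<lambda>z'. sqrt (1 + (partial 1 f z' + z' $ 2 / 2)\<^sup>2 + (partial 2 f z' - z' $ 1 / 2)\<^sup>2));
        H = mean_curvature f;
        \<tau> = tension (induced_metric f) gans_metric (gauss_map f) z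
    in \<tau> $ 1 + 2 * w z * partial 1 H z =
         H z * (2 * (fy - x / 2) / w z - 4 * partial 1 w z + 4 * (fx + y / 2) * H z * (w z)\<^sup>2)
     \<and> \<tau> $ 2 + 2 * w z * partial 2 H z =
         H z * (- 2 * (fx + y / 2) / w z - 4 * partial 2 w z + 4 * (fy - x / 2) * H z * (w z)\<^sup>2)"
    unfolding Let_def w
    using tension_gauss_map[OF assms z] by (simp only: slope_p_def slope_q_def)
qed

end
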